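(* The following two identities hold: \begin{align*} &\sum_{k=0}^{\infty}\frac{\binom{2k}{k}^5}{(-2^{12})^k}\left\{(20k^2+8k+1)\left[8H_{2k}^{(2)}-3H_{k}^{(2)}\right]+4\right\}=\frac{8}{3},\\ &\sum_{k=0}^{\infty}\frac{\binom{2k}{k}^5}{(-2^{20})^k}\left\{(820k^2+180k+13)\left[11H_{2k}^{(2)}-3H_{k}^{(2)}\right]+43\right\}=\frac{128}{3}. \end{align*}
   Context: For a positive integer $n$, $H_n^{(2)}=\sum_{j=1}^{n}\frac{1}{j^2}$ is the $n$-th harmonic number of order 2, and $H_0^{(2)}=0$ (empty sum). *)

theory Defs
  imports "HOL-Analysis.Analysis"
begin

definition harm2 :: "nat \<Rightarrow> real" where
  "harm2 n = (\<Sum>j=1..n. 1 / (real j)\<^sup>2)"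

end

theory Submission
  imports Defs "HOL-Real_Asymp.Real_Asymp"
begin

text \<open>
  Both series come from identities with a parameter \<open>y = x\<^sup>2\<close>, in which
  \<open>(1/2)_m\<^sup>2\<close> is replaced by \<open>(1/2 + x)_m (1/2 - x)_m\<close> and \<open>m!\<^sup>2\<close> by \<open>(1 + x)_m (1 - x)_m\<close>
  in some of the factors, and in which the right-hand side is a constant multiple of \<open>x cot (\<pi> x)\<close>.
  The harmonic numbers are the logarithmic derivatives of these products with respect to \<open>y\<close> at \<open>y = 0\<close>.
  The parametric identities have WZ pairs (arising from acceleration formulas for Dougall's
  sum at \<open>a = d = e = 1/2\<close>, \<open>b, c = 1/2 \<plusminus> x\<close>), and differentiating the WZ equation at \<open>y = 0\<close>
  yields a WZ pair \<open>(F, G)\<close> with \<open>F 0 k = 0\<close> for which \<open>- G n 0\<close> is the \<open>n\<close>-th term of the series.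
  Its sum is therefore \<open>- lim G 0 k\<close>, which is found from Wallis' product and \<open>\<zeta>(2) = \<pi>\<^sup>2/6\<close>.
\<close>

section \<open>Summation by a WZ pair\<close>

text \<open>Summing \<open>step\<close> over the rectangle \<open>n < N\<close>,
  \<open>k < K\<close> leaves only its edges, and the edge \<open>n = 0\<close> vanishes by
  \<open>F0\<close>. As K tends to infinity, the edge \<open>k = K\<close> tends to L; as N does,
  the edge \<open>n = N\<close> is killed by the majorant \<open>e N * b k\<close>.\<close>

lemma wz_sums:
  fixes F G :: "nat \<Rightarrow> nat \<Rightarrow> real"
  assumes step: "\<And>n k. F (Suc n) k - F n k = G n (Suc k) - G n k"
    and F0: "\<And>k. F 0 k = 0"
    and lim0: "G 0 \<longlonglongrightarrow> L"
    and lim: "\<And>n. n > 0 \<Longrightarrow> G n \<longlonglongrightarrow> 0"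
    and bound: "\<And>n k. n \<ge> m \<Longrightarrow> \<bar>F n k\<bar> \<le> e n * b k"
    and e: "e \<longlonglongrightarrow> 0" and b: "summable b" "\<And>k. b k \<ge> 0"
  shows "(\<lambda>n. - G n 0) sums (- L)"
proof -
  have fin: "(\<Sum>k<K. F N k) = (\<Sum>n<N. G n K - G n 0)" for N K
  proof (induction N)
    case 0
    show ?case by (simp add: F0)
  next
    case (Suc N)
    have "(\<Sum>k<K. F (Suc N) k) = (\<Sum>k<K. F N k) + (\<Sum>k<K. G N (Suc k) - G N k)"
      unfolding sum.distrib[symmetric] by (intro sum.cong refl) (simp add: step[symmetric])
    also have "(\<Sum>k<K. G N (Suc k) - G N k) = G N K - G N 0"
      by (rule sum_lessThan_telescope)
    finally show ?case using Suc by simp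
  qed
  have close: "\<bar>L + (\<Sum>n<N. - G n 0)\<bar> \<le> \<bar>e N\<bar> * suminf b" if N: "N \<ge> max m 1" for N
  proof (rule LIMSEQ_le_const2)
    \<comment> \<open>Only the row \<open>n = 0\<close> has the limit L, the others have limit 0;
      \<open>N \<ge> 1\<close> ensures that this row is present.\<close>
    have "(\<lambda>K. \<Sum>n<N. G n K - G n 0) \<longlonglongrightarrow> (\<Sum>n<N. (if n = 0 then L else 0) - G n 0)"
      by (intro tendsto_sum tendsto_diff tendsto_const) (auto intro: lim0 lim)
    also have "(\<Sum>n<N. (if n = 0 then L else 0) - G n 0) = L + (\<Sum>n<N. - G n 0)"
      using N by (simp add: sum_subtractf sum_negf)
    finally show "(\<lambda>K. \<bar>\<Sum>k<K. F N k\<bar>) \<longlonglongrightarrow> \<bar>L + (\<Sum>n<N. - G n 0)\<bar>"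
      unfolding fin by (rule tendsto_rabs)
    have "\<bar>\<Sum>k<K. F N k\<bar> \<le> \<bar>e N\<bar> * suminf b" for K
    proof -
      have "\<bar>\<Sum>k<K. F N k\<bar> \<le> (\<Sum>k<K. \<bar>e N\<bar> * b k)"
      proof (rule order_trans[OF sum_abs sum_mono])
        fix k
        have "e N * b k \<le> \<bar>e N\<bar> * b k" by (intro mult_right_mono b) simp
        then show "\<bar>F N k\<bar> \<le> \<bar>e N\<bar> * b k" using bound[of N k] N by linarith
      qed
      also have "\<dots> = \<bar>e N\<bar> * (\<Sum>k<K. b k)" by (simp add: sum_distrib_left)
      also have "\<dots> \<le> \<bar>e N\<bar> * suminf b"
        by (intro mult_left_mono sum_le_suminf b) (use b in auto)
      finally show ?thesis .
    qed
    then show "\<exists>K0. \<forall>K\<ge>K0. \<bar>\<Sum>k<K. F N k\<bar> \<le> \<bar>e N\<bar> * suminf b" by blast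
  qed
  have "(\<lambda>N. L + (\<Sum>n<N. - G n 0)) \<longlonglongrightarrow> 0"
  proof (rule Lim_null_comparison)
    show "\<forall>\<^sub>F N in sequentially. norm (L + (\<Sum>n<N. - G n 0)) \<le> \<bar>e N\<bar> * suminf b"
      using close by (auto simp: eventually_at_top_linorder simp del: max.bounded_iff)
    show "(\<lambda>N. \<bar>e N\<bar> * suminf b) \<longlonglongrightarrow> 0"
      using tendsto_mult[OF tendsto_rabs_zero[OF e] tendsto_const] by simp
  qed
  from tendsto_diff[OF this tendsto_const[of L]] show ?thesis
    by (simp add: sums_def)
qed

text \<open>Dual-number form of one WZ step: \<open>T * f\<close> and \<open>T * g\<close> are the values at the base point, \<open>\<phi>\<close>
  is the logarithmic derivative of \<open>T\<close>, and \<open>\<gamma>\<close> is the derivative of \<open>g\<close>.\<close>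

lemma wz_derivative_step:
  fixes T T\<^sub>n T\<^sub>k :: "'a :: comm_ring_1"
  assumes "T\<^sub>n * f\<^sub>n = T * R" "\<phi>\<^sub>n = \<phi> + \<rho>" "T\<^sub>k = T * s" "\<phi>\<^sub>k = \<phi> + \<sigma>"
    and "R - f = s * g\<^sub>k - g" "R * \<rho> = s * (\<sigma> * g\<^sub>k + \<gamma>\<^sub>k) - \<gamma>"
  shows "T\<^sub>n * f\<^sub>n * \<phi>\<^sub>n - T * f * \<phi> = T\<^sub>k * (\<phi>\<^sub>k * g\<^sub>k + \<gamma>\<^sub>k) - T * (\<phi> * g + \<gamma>)"
proof -
  have "T\<^sub>n * f\<^sub>n * \<phi>\<^sub>n - T * f * \<phi> = T * (\<phi> * (R - f) + R * \<rho>)"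
    unfolding assms(1,2) by (simp add: algebra_simps)
  \<comment> \<open>The multiples of \<phi> match by the undifferentiated equation, the rest by the
    differentiated one.\<close>
  also have "\<dots> = T\<^sub>k * (\<phi>\<^sub>k * g\<^sub>k + \<gamma>\<^sub>k) - T * (\<phi> * g + \<gamma>)"
    unfolding assms(3-6) by (simp add: algebra_simps)
  finally show ?thesis .
qed

section \<open>Normalized central binomial coefficients and harmonic sums\<close>

text \<open>This is \<open>(1/2)_m / m!\<close>.\<close>

definition cbin :: "nat \<Rightarrow> real" where
  "cbin m = real ((2 * m) choose m) / 4 ^ m"

text \<open>This is the sum of \<open>1 / (j + 1/2)\<^sup>2\<close> over \<open>j < m\<close>: minus
  the logarithmic derivative of \<open>(1/2 + x)_m (1/2 - x)_m\<close> in \<open>x\<^sup>2\<close>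
  at \<open>x = 0\<close>. For \<open>(1 + x)_m (1 - x)_m\<close> it is
  \<open>harm2 m\<close>.\<close>

definition odd_harm2 :: "nat \<Rightarrow> real" where
  "odd_harm2 m = 4 * harm2 (2 * m) - harm2 m"

lemma cbin_eq_fact: "cbin m = fact (2 * m) / (4 ^ m * (fact m)\<^sup>2)"
  by (simp add: cbin_def binomial_fact power2_eq_square mult_2)

lemma cbin_0 [simp]: "cbin 0 = 1"
  by (simp add: cbin_def)

lemma cbin_Suc: "cbin (Suc m) = cbin m * (real m + 1/2) / (real m + 1)"
proof -
  have "real m + 1 \<noteq> 0" by linarith
  then show ?thesis
    unfolding cbin_eq_fact by (simp add: divide_simps power2_eq_square) (simp add: algebra_simps)
qed

lemma cbin_pos: "cbin m > 0"
  by (simp add: cbin_eq_fact)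

lemma cbin_le_1: "cbin m \<le> 1"
proof (induction m)
  case (Suc m)
  have "cbin (Suc m) = cbin m * ((real m + 1/2) / (real m + 1))" by (simp add: cbin_Suc)
  also have "\<dots> \<le> 1 * 1" by (intro mult_mono Suc) (auto simp: divide_simps)
  finally show ?case by simp
qed simp

text \<open>The partial products of Wallis' product are exactly the reciprocals of these
  terms.\<close>

lemma cbin_asymp: "(\<lambda>m. (2 * real m + 1) * (cbin m)\<^sup>2) \<longlonglongrightarrow> 2 / pi"
proof -
  have eq: "(\<Prod>k=1..n. (4 * real k^2) / (4 * real k^2 - 1)) = 1 / ((2 * real n + 1) * (cbin n)\<^sup>2)" for n
  proof (induction n)
    case (Suc n)
    have "4 * real (Suc n)^2 - 1 = (2 * real n + 1) * (2 * real n + 3)"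
      by (simp add: power2_eq_square algebra_simps)
    then have "(\<Prod>k=1..Suc n. (4 * real k^2) / (4 * real k^2 - 1))
        = 1 / ((2 * real n + 1) * (cbin n)\<^sup>2) * (4 * (real n + 1)^2 / ((2 * real n + 1) * (2 * real n + 3)))"
      using Suc by (simp add: add.commute)
    also have "\<dots> = 1 / ((2 * real n + 3) * (cbin n * ((2 * real n + 1) / 2) / (real n + 1))\<^sup>2)"
      by (simp add: power_mult_distrib power_divide power2_eq_square mult_ac) (simp add: algebra_simps)
    also have "\<dots> = 1 / ((2 * real (Suc n) + 1) * (cbin (Suc n))\<^sup>2)"
      by (simp add: cbin_Suc add_divide_distrib)
    finally show ?case .
  qed simp
  have "(\<lambda>n. 1 / ((2 * real n + 1) * (cbin n)\<^sup>2)) \<longlonglongrightarrow> pi / 2"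
    using wallis unfolding eq .
  from tendsto_inverse[OF this] show ?thesis by (simp add: field_simps)
qed

lemma cbin_tendsto_0: "cbin \<longlonglongrightarrow> 0"
proof -
  have "(\<lambda>m::nat. 1 / (2 * real m + 1)) \<longlonglongrightarrow> 0" by real_asymp
  from tendsto_mult[OF cbin_asymp this]
  have "(\<lambda>m. ((2 * real m + 1) * (cbin m)\<^sup>2) * (1 / (2 * real m + 1))) \<longlonglongrightarrow> 0" by simp
  also have "(\<lambda>m. ((2 * real m + 1) * (cbin m)\<^sup>2) * (1 / (2 * real m + 1))) = (\<lambda>m. (cbin m)\<^sup>2)"
    by (rule ext) (simp add: divide_simps)
  finally show ?thesis by simp
qed

lemma harm2_0 [simp]: "harm2 0 = 0"
  by (simp add: harm2_def)

lemma harm2_Suc: "harm2 (Suc n) = harm2 n + 1 / (real n + 1)\<^sup>2"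
  by (simp add: harm2_def add.commute)

lemma odd_harm2_0 [simp]: "odd_harm2 0 = 0"
  by (simp add: odd_harm2_def)

lemma odd_harm2_Suc: "odd_harm2 (Suc n) = odd_harm2 n + 1 / (real n + 1/2)\<^sup>2"
proof -
  have "odd_harm2 (Suc n) =
      odd_harm2 n + 4 * (1 / (2 * real n + 1)\<^sup>2 + 1 / (2 * (real n + 1))\<^sup>2) - 1 / (real n + 1)\<^sup>2"
    by (simp add: odd_harm2_def harm2_Suc algebra_simps)
  also have "\<dots> = odd_harm2 n + 1 / ((2 * real n + 1) / 2)\<^sup>2"
    by (simp only: power_mult_distrib power_divide) simp
  also have "(2 * real n + 1) / 2 = real n + 1/2" by simp
  finally show ?thesis .
qed

lemma harm2_tendsto: "harm2 \<longlonglongrightarrow> pi\<^sup>2 / 6"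
proof -
  have "harm2 = (\<lambda>n. \<Sum>k<n. 1 / (real k + 1)\<^sup>2)"
  proof
    show "harm2 n = (\<Sum>k<n. 1 / (real k + 1)\<^sup>2)" for n
      by (induction n) (simp_all add: harm2_Suc)
  qed
  then show ?thesis
    using inverse_squares_sums by (simp add: sums_def add.commute)
qed

lemma odd_harm2_tendsto: "odd_harm2 \<longlonglongrightarrow> pi\<^sup>2 / 2"
proof -
  have "(\<lambda>n. harm2 (2 * n)) \<longlonglongrightarrow> pi\<^sup>2 / 6"
    by (rule filterlim_compose[OF harm2_tendsto]) real_asymp
  from tendsto_diff[OF tendsto_mult[OF tendsto_const[of 4] this] harm2_tendsto]
  show ?thesis unfolding odd_harm2_def by simp
qed

lemma harm2_bounds: "0 \<le> harm2 n" "harm2 n \<le> pi\<^sup>2 / 6"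
proof -
  have "incseq harm2" by (rule incseq_SucI) (simp add: harm2_Suc)
  then show "harm2 n \<le> pi\<^sup>2 / 6" using harm2_tendsto by (rule incseq_le)
  show "0 \<le> harm2 n" unfolding harm2_def by (intro sum_nonneg) simp
qed

lemma odd_harm2_bounds: "0 \<le> odd_harm2 n" "odd_harm2 n \<le> pi\<^sup>2 / 2"
proof -
  have inc: "incseq odd_harm2" by (rule incseq_SucI) (simp add: odd_harm2_Suc)
  then show "odd_harm2 n \<le> pi\<^sup>2 / 2" using odd_harm2_tendsto by (rule incseq_le)
  show "0 \<le> odd_harm2 n" using incseqD[OF inc, of 0 n] by simp
qed

section \<open>Estimates for factorial quotients\<close>

text \<open>Raising n by one costs a factor at most 1/2. Starting at \<open>n = 2\<close> secures
  cubic decay in k, which leaves a summable bound after \<open>F12\<close> multiplies by a factor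
  linear in k.\<close>

lemma fact_quotient_le:
  assumes "n \<ge> 2"
  shows "(fact n)\<^sup>2 * fact k / fact (2 * n + k) \<le> 16 * (1/2) ^ n / (real k + 1) ^ 3"
  using assms
proof (induction n rule: nat_induct_at_least)
  case base
  have "fact (2 * 2 + k) = (real k + 4) * (real k + 3) * (real k + 2) * (real k + 1) * fact k"
    by (simp add: numeral_eq_Suc algebra_simps)
  then have "(fact 2)\<^sup>2 * fact k / fact (2 * 2 + k)
      = 4 / ((real k + 4) * (real k + 3) * (real k + 2) * (real k + 1))"
    by (simp add: fact_2)
  also have "\<dots> \<le> 4 / (1 * (real k + 1) * (real k + 1) * (real k + 1))"
    by (intro divide_left_mono mult_mono mult_pos_pos) auto
  finally show ?case by (simp add: power3_eq_cube power2_eq_square)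
next
  case (Suc n)
  have "(fact (Suc n))\<^sup>2 * fact k / fact (2 * Suc n + k)
      = (fact n)\<^sup>2 * fact k / fact (2 * n + k) *
        ((real n + 1)\<^sup>2 / ((2 * real n + real k + 2) * (2 * real n + real k + 1)))"
    by (simp add: power2_eq_square mult_ac add_ac)
  also have "\<dots> \<le> 16 * (1/2) ^ n / (real k + 1) ^ 3 * (1/2)"
  proof (intro mult_mono Suc)
    have "(real n + 1)\<^sup>2 / ((2 * real n + real k + 2) * (2 * real n + real k + 1))
        \<le> (real n + 1)\<^sup>2 / ((2 * real n + 2) * (real n + 1))"
      by (intro divide_left_mono mult_mono mult_pos_pos) auto
    also have "\<dots> = 1 / 2" by (simp add: divide_simps power2_eq_square) 
    finally show "(real n + 1)\<^sup>2 / ((2 * real n + real k + 2) * (2 * real n + real k + 1)) \<le> 1 / 2" .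
  qed auto
  finally show ?case by simp
qed

text \<open>The source of the geometric decay of \<open>term20\<close> in n: the left side is the
  reciprocal of a central binomial coefficient, and each step at least halves it.\<close>

lemma fact_square_quotient_le: "(fact n)\<^sup>2 / fact (2 * n) \<le> (1/2 :: real) ^ n"
proof (induction n)
  case (Suc n)
  have "(fact (Suc n))\<^sup>2 / fact (2 * Suc n)
      = (fact n)\<^sup>2 / fact (2 * n) * ((real n + 1)\<^sup>2 / ((2 * real n + 2) * (2 * real n + 1)))"
    by (simp add: power2_eq_square mult_ac add_ac)
  also have "\<dots> \<le> (1/2) ^ n * (1/2)"
  proof (intro mult_mono Suc)
    have "(real n + 1)\<^sup>2 / ((2 * real n + 2) * (2 * real n + 1))
        \<le> (real n + 1)\<^sup>2 / ((2 * real n + 2) * (real n + 1))"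
      by (intro divide_left_mono mult_mono mult_pos_pos) auto
    also have "\<dots> = 1 / 2" by (simp add: divide_simps power2_eq_square)
    finally show "(real n + 1)\<^sup>2 / ((2 * real n + 2) * (2 * real n + 1)) \<le> 1 / 2" .
  qed auto
  finally show ?case by simp
qed simp

text \<open>The source of the decay of \<open>term20\<close> in k: already present at
  \<open>n = 1\<close>, and preserved since each step in n multiplies by at most 1.\<close>

lemma fact_shift_quotient_le:
  assumes "n \<ge> 1"
  shows "fact (n + k) * fact n / fact (2 * n + k) \<le> 1 / (real k + 1)"
  using assms
proof (induction n rule: nat_induct_at_least)
  case base
  have "fact (1 + k) * fact 1 / fact (2 * 1 + k) = 1 / (real k + 2)"
    by (simp add: numeral_eq_Suc divide_simps)
  also have "\<dots> \<le> 1 / (real k + 1)" by (simp add: divide_simps)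
  finally show ?case .
next
  case (Suc n)
  have "fact (Suc n + k) * fact (Suc n) / fact (2 * Suc n + k)
      = fact (n + k) * fact n / fact (2 * n + k) *
        ((real n + real k + 1) * (real n + 1) / ((2 * real n + real k + 2) * (2 * real n + real k + 1)))"
    by (simp add: mult_ac add_ac)
  also have "\<dots> \<le> 1 / (real k + 1) * 1"
  proof (intro mult_mono Suc)
    have "(real n + real k + 1) * (real n + 1) \<le> (2 * real n + real k + 2) * (2 * real n + real k + 1)"
      by (intro mult_mono) auto
    then show "(real n + real k + 1) * (real n + 1) / ((2 * real n + real k + 2) * (2 * real n + real k + 1)) \<le> 1"
      by (simp add: divide_simps)
  qed auto
  finally show ?case by simp
qed

section \<open>Limits along k for fixed n\<close>

text \<open>Used for \<open>G n k\<close> as k grows: the certificate g grows quadratically and is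
  balanced by T, while \<gamma> is of lower order and drops out. The weight
  \<open>(2 * real k + 1)\<^sup>2\<close> is the one that comes from squaring
  \<open>cbin_asymp\<close>.\<close>

lemma boundary_tendsto:
  fixes T \<phi> g \<gamma> :: "nat \<Rightarrow> real"
  assumes "(\<lambda>k. T k * (2 * real k + 1)\<^sup>2) \<longlonglongrightarrow> \<tau>" "\<phi> \<longlonglongrightarrow> p"
    and "(\<lambda>k. g k / (2 * real k + 1)\<^sup>2) \<longlonglongrightarrow> a" "(\<lambda>k. \<gamma> k / (2 * real k + 1)\<^sup>2) \<longlonglongrightarrow> 0"
  shows "(\<lambda>k. T k * (\<phi> k * g k + \<gamma> k)) \<longlonglongrightarrow> \<tau> * (p * a)"
proof -
  have "(\<lambda>k. T k * (2 * real k + 1)\<^sup>2 * (\<phi> k * (g k / (2 * real k + 1)\<^sup>2) + \<gamma> k / (2 * real k + 1)\<^sup>2))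
      \<longlonglongrightarrow> \<tau> * (p * a + 0)"
    by (intro tendsto_intros assms)
  also have "(\<lambda>k. T k * (2 * real k + 1)\<^sup>2 * (\<phi> k * (g k / (2 * real k + 1)\<^sup>2) + \<gamma> k / (2 * real k + 1)\<^sup>2))
      = (\<lambda>k. T k * (\<phi> k * g k + \<gamma> k))"
  proof
    fix k :: nat
    have "2 * real k + 1 \<noteq> 0" by linarith
    then show "T k * (2 * real k + 1)\<^sup>2 * (\<phi> k * (g k / (2 * real k + 1)\<^sup>2) + \<gamma> k / (2 * real k + 1)\<^sup>2)
        = T k * (\<phi> k * g k + \<gamma> k)"
      by (simp add: distrib_left mult.assoc)
  qed
  finally show ?thesis by simp
qed

text \<open>Serves the row \<open>n = 0\<close>, where both \<open>term12 0 k\<close> and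
  \<open>term20 0 k\<close> equal \<open>cbin k ^ 4\<close>.\<close>

lemma cbin_power4_tendsto: "(\<lambda>k. cbin k ^ 4 * (2 * real k + 1)\<^sup>2) \<longlonglongrightarrow> 4 / pi\<^sup>2"
  using tendsto_power[OF cbin_asymp, of 2]
  by (simp add: power_mult_distrib power_divide mult.commute flip: power_mult)

text \<open>Serves the rows \<open>n > 0\<close>: the weight is absorbed by the quadratic decay, and
  the spare factor \<open>cbin (n + k)\<close> tends to 0.\<close>

lemma cbin_shift_null:
  assumes "\<And>k. \<bar>T k\<bar> \<le> C * cbin (n + k) / (real k + 1)\<^sup>2" "C \<ge> 0"
  shows "(\<lambda>k. T k * (2 * real k + 1)\<^sup>2) \<longlonglongrightarrow> 0"
proof (rule Lim_null_comparison)
  have "norm (T k * (2 * real k + 1)\<^sup>2) \<le> 4 * C * cbin (n + k)" for k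
  proof -
    have "norm (T k * (2 * real k + 1)\<^sup>2) \<le> C * cbin (n + k) / (real k + 1)\<^sup>2 * (2 * (real k + 1))\<^sup>2"
      unfolding real_norm_def abs_mult using assms cbin_pos[of "n + k"]
      by (intro mult_mono) (auto intro: power_mono divide_nonneg_nonneg)
    also have "\<dots> = 4 * C * cbin (n + k)"
      unfolding power_mult_distrib by simp
    finally show ?thesis .
  qed
  then show "\<forall>\<^sub>F k in sequentially. norm (T k * (2 * real k + 1)\<^sup>2) \<le> 4 * C * cbin (n + k)" by simp
  have "(\<lambda>k. cbin (n + k)) \<longlonglongrightarrow> 0"
    using LIMSEQ_ignore_initial_segment[OF cbin_tendsto_0, of n] by (simp add: add.commute)
  from tendsto_mult[OF tendsto_const[of "4 * C"] this]
  show "(\<lambda>k. 4 * C * cbin (n + k)) \<longlonglongrightarrow> 0" by simp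
qed

section \<open>The series with base $-2^{12}$\<close>

text \<open>\<open>term12 n k\<close> is the value at \<open>x = 0\<close> of
  \<open>(-1)^n (1/2 + x)_(n+k) (1/2 - x)_(n+k) (1/2)_(n+k) (1/2 + x)_n (1/2 - x)_n (1/2)_n (1/2)_k\<close> divided by
  \<open>(1 + x)_(n+k) (1 - x)_(n+k) (n+k)! (2n+k)! n!\<close>, and \<open>dlog12 n k\<close> is the logarithmic derivative of this in \<open>x\<^sup>2\<close>.
  The rational certificates below were found by solving linear equations for their coefficients.\<close>

definition term12 :: "nat \<Rightarrow> nat \<Rightarrow> real" where
  "term12 n k = (-1) ^ n * cbin (n + k) ^ 3 * cbin n ^ 3 * cbin k * ((fact n)\<^sup>2 * fact k / fact (2 * n + k))"

definition dlog12 :: "nat \<Rightarrow> nat \<Rightarrow> real" where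
  "dlog12 n k = harm2 (n + k) - odd_harm2 (n + k) - odd_harm2 n"

definition cert12 :: "real \<Rightarrow> real \<Rightarrow> real" where
  "cert12 t c = 8 * c\<^sup>2 - 8 * c * t + 8 * t\<^sup>2 - 8 * t ^ 3 / c - 8 * c + 4 * t + 2"

text \<open>The derivative at \<open>y = 0\<close> of \<open>cert12\<close> after
  \<open>t\<^sup>2\<close> is replaced by \<open>t\<^sup>2 - y\<close> in
  \<open>8 * t\<^sup>2 - 8 * t ^ 3 / c\<close>.\<close>

definition dcert12 :: "real \<Rightarrow> real \<Rightarrow> real" where
  "dcert12 t c = 8 * (t / c - 1)"

text \<open>The factor \<open>4 * real n\<close> gives \<open>F12 0 k = 0\<close>. The polynomial is
  free of x, so differentiation only brings in \<open>dlog12\<close>.\<close>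

definition F12 :: "nat \<Rightarrow> nat \<Rightarrow> real" where
  "F12 n k = term12 n k * (4 * real n * (4 * real n + 4 * real k + 1)) * dlog12 n k"

definition G12 :: "nat \<Rightarrow> nat \<Rightarrow> real" where
  "G12 n k = term12 n k * (dlog12 n k * cert12 (real n + 1/2) (2 * real n + real k + 1)
     + dcert12 (real n + 1/2) (2 * real n + real k + 1))"

section \<open>The WZ equation and its derivative, base $-2^{12}$\<close>

text \<open>The WZ equation at \<open>x = 0\<close> divided by \<open>term12 n k\<close>, with
  \<open>v = n + k + 1\<close>. Multiplied by \<open>v ^ 3 * c * d\<close> it is a polynomial
  identity in t and c.\<close>

lemma cert12_step:
  fixes t c d u v :: real
  assumes "c \<noteq> 0" "d \<noteq> 0" "v \<noteq> 0" "d = c + 1" "u = c - t" "v = u + 1/2"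
  shows "- 4 * u ^ 3 * t ^ 3 * (4 * u + 3) / (v ^ 3 * c * d) - 4 * (t - 1/2) * (4 * u - 1)
    = u ^ 3 * (v - t) / (v ^ 3 * c) * cert12 t d - cert12 t c"
proof -
  have "- 4 * u ^ 3 * t ^ 3 * (4 * u + 3) - 4 * (t - 1/2) * (4 * u - 1) * (v ^ 3 * c * d)
    = u ^ 3 * (v - t) * ((8 * d\<^sup>2 - 8 * d * t + 8 * t\<^sup>2 - 8 * d + 4 * t + 2) * d - 8 * t ^ 3)
     - ((8 * c\<^sup>2 - 8 * c * t + 8 * t\<^sup>2 - 8 * c + 4 * t + 2) * c - 8 * t ^ 3) * v ^ 3 * d"
    unfolding assms(4-6) by algebra
  then show ?thesis
    unfolding cert12_def using assms(1-3) by (simp add: divide_simps) (simp add: algebra_simps)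
qed

text \<open>The derivative of the previous equation in \<open>x\<^sup>2\<close>. The logarithmic
  derivatives are multiplied into the powers of t and u, so that only c, d and v are
  denominators.\<close>

lemma dcert12_step:
  fixes t c d u v :: real
  assumes "c \<noteq> 0" "d \<noteq> 0" "v \<noteq> 0" "d = c + 1" "u = c - t" "v = u + 1/2"
  shows "4 * u * t * (4 * u + 3) / (v ^ 3 * c * d) * (t\<^sup>2 + u\<^sup>2 - t\<^sup>2 * u\<^sup>2 / v\<^sup>2)
    = (v - t) / (v ^ 3 * c) * ((u ^ 3 / v\<^sup>2 - u) * cert12 t d + u ^ 3 * dcert12 t d) - dcert12 t c"
proof -
  have "4 * u * t * (4 * u + 3) * ((t\<^sup>2 + u\<^sup>2) * v\<^sup>2 - t\<^sup>2 * u\<^sup>2)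
    = (v - t) * ((u ^ 3 - u * v\<^sup>2) * ((8 * d\<^sup>2 - 8 * d * t + 8 * t\<^sup>2 - 8 * d + 4 * t + 2) * d - 8 * t ^ 3)
     + u ^ 3 * v\<^sup>2 * (8 * (t - d))) - 8 * (t - c) * v ^ 5 * d" (is "?l = ?r")
    unfolding assms(4-6) by algebra
  then have "?l / (v ^ 5 * c * d) = ?r / (v ^ 5 * c * d)" by simp
  moreover have "?l / (v ^ 5 * c * d)
      = 4 * u * t * (4 * u + 3) / (v ^ 3 * c * d) * (t\<^sup>2 + u\<^sup>2 - t\<^sup>2 * u\<^sup>2 / v\<^sup>2)"
    using assms(1-3) by (simp add: divide_simps power_numeral_reduce)
  moreover have "?r / (v ^ 5 * c * d)
      = (v - t) / (v ^ 3 * c) * ((u ^ 3 / v\<^sup>2 - u) * cert12 t d + u ^ 3 * dcert12 t d) - dcert12 t c"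
    unfolding cert12_def dcert12_def
    using assms(1-3) by (simp add: divide_simps power_numeral_reduce) (simp add: algebra_simps)
  ultimately show ?thesis by simp
qed

lemma term12_Suc_left:
  fixes n k :: nat
  defines "t \<equiv> real n + 1/2" and "c \<equiv> 2 * real n + real k + 1" and "u \<equiv> real n + real k + 1/2"
  shows "term12 (Suc n) k * (4 * real (Suc n) * (4 * real (Suc n) + 4 * real k + 1))
    = term12 n k * (- 4 * u ^ 3 * t ^ 3 * (4 * u + 3) / ((u + 1/2) ^ 3 * c * (c + 1)))"
proof -
  define q where "q = (fact n)\<^sup>2 * fact k / (fact (2 * n + k) :: real)"
  have q: "(fact (Suc n))\<^sup>2 * fact k / fact (2 * Suc n + k) = q * ((t + 1/2)\<^sup>2 / (c * (c + 1)))"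
    unfolding q_def t_def c_def by (simp add: power2_eq_square mult_ac add_ac)
  have h: "cbin (Suc n + k) = cbin (n + k) * u / (u + 1/2)" "cbin (Suc n) = cbin n * t / (t + 1/2)"
    unfolding t_def u_def by (simp_all add: cbin_Suc)
  have f: "4 * real (Suc n) * (4 * real (Suc n) + 4 * real k + 1) = 4 * (t + 1/2) * (4 * u + 3)"
    unfolding t_def u_def by (simp add: algebra_simps)
  \<comment> \<open>The three powers of \<open>t + 1/2\<close> below \<open>cbin (Suc n) ^ 3\<close>
    cancel against two from the factorials and one from the factor
    \<open>4 * real (Suc n)\<close>.\<close>
  have "t + 1/2 \<noteq> 0" unfolding t_def by linarith
  then have p: "(t / (t + 1/2)) ^ 3 * ((t + 1/2)\<^sup>2 * (t + 1/2)) = t ^ 3"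
    by (simp add: power_divide power2_eq_square power3_eq_cube)
  have "term12 (Suc n) k * (4 * real (Suc n) * (4 * real (Suc n) + 4 * real k + 1))
      = - ((-1) ^ n * cbin (n + k) ^ 3 * cbin n ^ 3 * cbin k * q * (4 * u ^ 3 * (4 * u + 3) / ((u + 1/2) ^ 3 * (c * (c + 1)))))
        * ((t / (t + 1/2)) ^ 3 * ((t + 1/2)\<^sup>2 * (t + 1/2)))"
    unfolding term12_def q f h
    by (simp only: times_divide_eq_right[symmetric] power_mult_distrib) (simp add: power_divide mult_ac)
  also have "\<dots> = term12 n k * (- 4 * u ^ 3 * t ^ 3 * (4 * u + 3) / ((u + 1/2) ^ 3 * c * (c + 1)))"
    unfolding p term12_def q_def by (simp add: mult_ac)
  finally show ?thesis .
qed

lemma term12_Suc_right: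
  fixes n k :: nat
  defines "t \<equiv> real n + 1/2" and "c \<equiv> 2 * real n + real k + 1" and "u \<equiv> real n + real k + 1/2"
  shows "term12 n (Suc k) = term12 n k * (u ^ 3 * (u + 1/2 - t) / ((u + 1/2) ^ 3 * c))"
proof -
  \<comment> \<open>Here \<open>u + 1/2 - t\<close> is \<open>real k + 1/2\<close>, and the
    denominator \<open>real k + 1\<close> cancels against \<open>fact (Suc k)\<close>.\<close>
  have h: "cbin (n + Suc k) = cbin (n + k) * u / (u + 1/2)" "cbin (Suc k) = cbin k * (u + 1/2 - t) / (real k + 1)"
    unfolding t_def u_def by (simp_all add: cbin_Suc)
  have q: "(fact n)\<^sup>2 * fact (Suc k) / fact (2 * n + Suc k)
      = (fact n)\<^sup>2 * fact k / fact (2 * n + k) * ((real k + 1) / c)"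
    unfolding c_def by (simp add: mult_ac add_ac)
  show ?thesis
    unfolding term12_def h q by (simp add: power_mult_distrib power_divide mult_ac)
qed

lemma dlog12_Suc_left:
  "dlog12 (Suc n) k = dlog12 n k + (1 / (real n + real k + 1)\<^sup>2 - 1 / (real n + real k + 1/2)\<^sup>2 - 1 / (real n + 1/2)\<^sup>2)"
  by (simp add: dlog12_def harm2_Suc odd_harm2_Suc)

lemma dlog12_Suc_right:
  "dlog12 n (Suc k) = dlog12 n k + (1 / (real n + real k + 1)\<^sup>2 - 1 / (real n + real k + 1/2)\<^sup>2)"
  by (simp add: dlog12_def harm2_Suc odd_harm2_Suc)

lemma wz12: "F12 (Suc n) k - F12 n k = G12 n (Suc k) - G12 n k"
proof -
  define t c d u v where "t = real n + 1/2" and "c = 2 * real n + real k + 1"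
    and "d = c + 1" and "u = real n + real k + 1/2" and "v = u + 1/2"
  have nz: "t \<noteq> 0" "c \<noteq> 0" "d \<noteq> 0" "u \<noteq> 0" "v \<noteq> 0" and uc: "u = c - t"
    unfolding t_def c_def d_def u_def v_def by linarith+
  have f: "4 * real n * (4 * real n + 4 * real k + 1) = 4 * (t - 1/2) * (4 * u - 1)"
    unfolding t_def u_def by (simp add: algebra_simps)
  have c: "2 * real n + real (Suc k) + 1 = d" unfolding c_def d_def by simp
  have v: "real n + real k + 1 = v" unfolding u_def v_def by simp
  note left = term12_Suc_left[of n k, folded t_def c_def u_def, folded d_def v_def]
  note right = term12_Suc_right[of n k, folded t_def c_def u_def, folded v_def]
  note dleft = dlog12_Suc_left[of n k, folded t_def u_def, unfolded v]
  note dright = dlog12_Suc_right[of n k, folded u_def, unfolded v]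
  \<comment> \<open>This chain brings \<open>dcert12_step\<close> into the shape
    \<open>R * \<rho> = s * (\<sigma> * g + \<gamma>) - \<gamma>\<close> of
    \<open>wz_derivative_step\<close>.\<close>
  have "- 4 * u ^ 3 * t ^ 3 * (4 * u + 3) / (v ^ 3 * c * d) * (1 / v\<^sup>2 - 1 / u\<^sup>2 - 1 / t\<^sup>2)
      = - 4 * ((4 * u + 3) / (v ^ 3 * c * d)) * (u ^ 3 * t ^ 3 * (1 / v\<^sup>2 - 1 / u\<^sup>2 - 1 / t\<^sup>2))"
    by (simp only: divide_inverse mult_ac)
  also have "u ^ 3 * t ^ 3 * (1 / v\<^sup>2 - 1 / u\<^sup>2 - 1 / t\<^sup>2) = - (u * t * (t\<^sup>2 + u\<^sup>2 - t\<^sup>2 * u\<^sup>2 / v\<^sup>2))"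
    using nz by (simp add: field_simps power2_eq_square power3_eq_cube)
  also have "- 4 * ((4 * u + 3) / (v ^ 3 * c * d)) * \<dots>
      = 4 * u * t * (4 * u + 3) / (v ^ 3 * c * d) * (t\<^sup>2 + u\<^sup>2 - t\<^sup>2 * u\<^sup>2 / v\<^sup>2)"
    by (simp only: divide_inverse mult_minus_left mult_minus_right minus_minus mult_ac)
  also have "\<dots> = (v - t) / (v ^ 3 * c) * ((u ^ 3 / v\<^sup>2 - u) * cert12 t d + u ^ 3 * dcert12 t d) - dcert12 t c"
    by (rule dcert12_step) (use nz uc d_def v_def in auto)
  also have "u ^ 3 / v\<^sup>2 - u = u ^ 3 * (1 / v\<^sup>2 - 1 / u\<^sup>2)"
    using nz by (simp add: field_simps power2_eq_square power3_eq_cube)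
  also have "(v - t) / (v ^ 3 * c) * (u ^ 3 * (1 / v\<^sup>2 - 1 / u\<^sup>2) * cert12 t d + u ^ 3 * dcert12 t d)
      = u ^ 3 * (v - t) / (v ^ 3 * c) * ((1 / v\<^sup>2 - 1 / u\<^sup>2) * cert12 t d + dcert12 t d)"
    by (simp only: divide_inverse distrib_left mult_ac)
  finally have deriv: "- 4 * u ^ 3 * t ^ 3 * (4 * u + 3) / (v ^ 3 * c * d) * (1 / v\<^sup>2 - 1 / u\<^sup>2 - 1 / t\<^sup>2)
      = u ^ 3 * (v - t) / (v ^ 3 * c) * ((1 / v\<^sup>2 - 1 / u\<^sup>2) * cert12 t d + dcert12 t d) - dcert12 t c" .
  show ?thesis
    unfolding F12_def G12_def c f
    unfolding t_def[symmetric] c_def[symmetric]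
    by (rule wz_derivative_step[OF left dleft right dright _ deriv], rule cert12_step)
       (use nz uc d_def v_def in auto)
qed

section \<open>Limits, bounds and summation, base $-2^{12}$\<close>

lemma dlog12_bound: "\<bar>dlog12 n k\<bar> \<le> 2 * pi\<^sup>2"
  using harm2_bounds[of "n + k"] odd_harm2_bounds[of "n + k"] odd_harm2_bounds[of n]
  unfolding dlog12_def by (simp add: abs_le_iff)

lemma dlog12_tendsto: "dlog12 n \<longlonglongrightarrow> - (pi\<^sup>2 / 3) - odd_harm2 n"
proof -
  have "(\<lambda>k. harm2 (n + k) - odd_harm2 (n + k) - odd_harm2 n) \<longlonglongrightarrow> pi\<^sup>2 / 6 - pi\<^sup>2 / 2 - odd_harm2 n"
    using LIMSEQ_ignore_initial_segment[OF harm2_tendsto, of n]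
      LIMSEQ_ignore_initial_segment[OF odd_harm2_tendsto, of n]
    by (intro tendsto_diff tendsto_const) (simp_all add: add.commute)
  then show ?thesis unfolding dlog12_def by simp
qed

lemma cert12_tendsto:
  "(\<lambda>k. cert12 t (2 * real n + real k + 1) / (2 * real k + 1)\<^sup>2) \<longlonglongrightarrow> 2"
  unfolding cert12_def by real_asymp

lemma dcert12_tendsto:
  "(\<lambda>k. dcert12 t (2 * real n + real k + 1) / (2 * real k + 1)\<^sup>2) \<longlonglongrightarrow> 0"
  unfolding dcert12_def by real_asymp

lemma term12_tendsto_0:
  assumes "n > 0"
  shows "(\<lambda>k. term12 n k * (2 * real k + 1)\<^sup>2) \<longlonglongrightarrow> 0"
proof (rule cbin_shift_null)
  fix k
  have "(real k + 1)\<^sup>2 * fact k \<le> (real k + 2) * (real k + 1) * fact k"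
    unfolding power2_eq_square by (intro mult_right_mono) auto
  also have "\<dots> = fact (2 + k)" by (simp add: numeral_eq_Suc algebra_simps)
  also have "\<dots> \<le> fact (2 * n + k)" using assms by (intro fact_mono) auto
  finally have "fact k / fact (2 * n + k) \<le> 1 / (real k + 1)\<^sup>2"
    by (simp add: divide_simps mult_ac)
  then have q: "(fact n)\<^sup>2 * fact k / fact (2 * n + k) \<le> (fact n)\<^sup>2 * (1 / (real k + 1)\<^sup>2)"
    unfolding times_divide_eq_right[symmetric] by (rule mult_left_mono) simp
  have "\<bar>term12 n k\<bar> = cbin (n + k) * (cbin (n + k) ^ 2 * cbin n ^ 3 * cbin k) * ((fact n)\<^sup>2 * fact k / fact (2 * n + k))"
    unfolding term12_def using cbin_pos by (simp add: abs_mult power_abs less_imp_le power2_eq_square power3_eq_cube)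
  also have "\<dots> \<le> cbin (n + k) * (1 ^ 2 * 1 ^ 3 * 1) * ((fact n)\<^sup>2 * (1 / (real k + 1)\<^sup>2))"
    using cbin_pos by (intro mult_mono power_mono cbin_le_1 q) (auto intro!: mult_nonneg_nonneg simp: less_imp_le)
  finally show "\<bar>term12 n k\<bar> \<le> (fact n)\<^sup>2 * cbin (n + k) / (real k + 1)\<^sup>2" by (simp add: mult_ac)
qed simp

lemma F12_bound:
  assumes "n \<ge> 2"
  shows "\<bar>F12 n k\<bar> \<le> (512 * pi\<^sup>2 * real n * (real n + 1) * (1/2) ^ n) * (1 / (real k + 1)\<^sup>2)"
proof -
  have "\<bar>term12 n k\<bar> = (cbin (n + k) ^ 3 * cbin n ^ 3 * cbin k) * ((fact n)\<^sup>2 * fact k / fact (2 * n + k))"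
    unfolding term12_def using cbin_pos by (simp add: abs_mult power_abs less_imp_le)
  also have "\<dots> \<le> (1 ^ 3 * 1 ^ 3 * 1) * (16 * (1/2) ^ n / (real k + 1) ^ 3)"
    using cbin_pos assms
    by (intro mult_mono power_mono cbin_le_1 fact_quotient_le) (auto intro!: mult_nonneg_nonneg simp: less_imp_le)
  finally have T: "\<bar>term12 n k\<bar> \<le> 16 * (1/2) ^ n / (real k + 1) ^ 3" by simp
  \<comment> \<open>Splitting the factor as a product in n and k costs one of the three powers of
    \<open>real k + 1\<close>; two remain for summability.\<close>
  have f: "4 * real n * (4 * real n + 4 * real k + 1) \<le> 4 * real n * (4 * ((real n + 1) * (real k + 1)))"
    by (intro mult_left_mono) (auto simp: algebra_simps)
  have "\<bar>F12 n k\<bar> = \<bar>term12 n k\<bar> * (4 * real n * (4 * real n + 4 * real k + 1)) * \<bar>dlog12 n k\<bar>"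
    unfolding F12_def by (simp add: abs_mult)
  also have "\<dots> \<le> 16 * (1/2) ^ n / (real k + 1) ^ 3 * (4 * real n * (4 * ((real n + 1) * (real k + 1)))) * (2 * pi\<^sup>2)"
    by (intro mult_mono T f dlog12_bound) (auto intro!: mult_nonneg_nonneg)
  also have "\<dots> = (512 * pi\<^sup>2 * real n * (real n + 1) * (1/2) ^ n) * (1 / (real k + 1)\<^sup>2)"
    by (simp add: power2_eq_square power3_eq_cube)
  finally show ?thesis .
qed

lemma sums12: "(\<lambda>n. - G12 n 0) sums (8 / 3)"
proof -
  have "(\<lambda>n. - G12 n 0) sums (- (- 8 / 3))"
  proof (rule wz_sums[where F = F12 and G = G12 and m = 2, OF wz12])
    have "(\<lambda>k. term12 0 k * (2 * real k + 1)\<^sup>2) \<longlonglongrightarrow> 4 / pi\<^sup>2"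
      using cbin_power4_tendsto by (simp add: term12_def flip: power_Suc2)
    \<comment> \<open>The limit of \<open>dlog12 0\<close> is \<open>- pi\<^sup>2 / 3\<close> and
      that of the scaled certificate is 2, so \<open>pi\<^sup>2\<close> cancels.\<close>
    then have "G12 0 \<longlonglongrightarrow> 4 / pi\<^sup>2 * ((- (pi\<^sup>2 / 3) - odd_harm2 0) * 2)"
      unfolding G12_def by (intro boundary_tendsto dlog12_tendsto cert12_tendsto dcert12_tendsto)
    then show "G12 0 \<longlonglongrightarrow> - 8 / 3" by simp
    show "G12 n \<longlonglongrightarrow> 0" if "n > 0" for n
      using boundary_tendsto[OF term12_tendsto_0[OF that] dlog12_tendsto cert12_tendsto dcert12_tendsto]
      unfolding G12_def by simp
    show "(\<lambda>n. 512 * pi\<^sup>2 * real n * (real n + 1) * (1/2) ^ n) \<longlonglongrightarrow> 0" by real_asymp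
    show "summable (\<lambda>k. 1 / (real k + 1)\<^sup>2)" using inverse_squares_sums by (simp add: sums_iff add.commute)
  qed (use F12_bound in \<open>auto simp: F12_def\<close>)
  then show ?thesis by simp
qed

section \<open>Evaluation at \<open>k = 0\<close>, base $-2^{12}$\<close>

lemma term12_0_right: "term12 n 0 = real ((2 * n) choose n) ^ 5 / (- (2 ^ 12)) ^ n"
proof -
  \<comment> \<open>At \<open>k = 0\<close> the factorial quotient is
    \<open>1 / (4 ^ n * cbin n)\<close>. The remaining \<open>cbin n ^ 5\<close> holds another
    \<open>4 ^ (5 * n)\<close> in its denominator, and \<open>4 ^ 6 = 2 ^ 12\<close>.\<close>
  have "term12 n 0 = (-1) ^ n * cbin n ^ 6 * (1 / (4 ^ n * cbin n))"
    unfolding term12_def by (simp add: cbin_eq_fact power2_eq_square mult_ac flip: power_add)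
  also have "\<dots> = (-1) ^ n * cbin n ^ 5 / 4 ^ n"
    using cbin_pos[of n] by (simp add: numeral_eq_Suc)
  also have "\<dots> = real ((2 * n) choose n) ^ 5 / ((-1) ^ n * (4 ^ n) ^ 6)"
    by (simp add: cbin_def power_divide numeral_eq_Suc minus_one_power_iff)
  also have "(-1) ^ n * (4 ^ n) ^ 6 = (- (2 ^ 12) :: real) ^ n"
    by (simp add: power_mult[symmetric] mult.commute[of n] power_mult flip: power_mult_distrib)
  finally show ?thesis .
qed

text \<open>At \<open>k = 0\<close> one has \<open>c = 2 * t\<close>, so the certificate collapses
  to \<open>20 * t\<^sup>2 - 12 * t + 2\<close> with \<open>t = x + 1/2\<close>.\<close>

lemma cert12_0_right:
  fixes x :: real
  assumes "x \<ge> 0"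
  shows "cert12 (x + 1/2) (2 * x + 1) = 20 * x\<^sup>2 + 8 * x + 1"
    and "dcert12 (x + 1/2) (2 * x + 1) = - 4"
proof -
  have c: "2 * x + 1 = 2 * (x + 1/2)" by simp
  have nz: "x + 1/2 \<noteq> 0" using assms by linarith
  have "w ^ 3 / (2 * w) = w\<^sup>2 / 2" if "w \<noteq> 0" for w :: real
    using that by (simp add: power2_eq_square power3_eq_cube)
  from this[OF nz] show "cert12 (x + 1/2) (2 * x + 1) = 20 * x\<^sup>2 + 8 * x + 1"
    unfolding cert12_def c times_divide_eq_right[symmetric]
    by (simp add: power2_eq_square algebra_simps)
  have half: "w / (2 * w) = 1 / 2" if "w \<noteq> 0" for w :: real
    using that by simp
  show "dcert12 (x + 1/2) (2 * x + 1) = - 4"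
    unfolding dcert12_def c half[OF nz] by simp
qed

lemma series12:
  "(\<lambda>k. real ((2 * k) choose k) ^ 5 / (- (2 ^ 12)) ^ k *
     ((20 * (real k)\<^sup>2 + 8 * real k + 1) * (8 * harm2 (2 * k) - 3 * harm2 k) + 4)) sums (8 / 3)"
proof -
  have "- G12 n 0 = real ((2 * n) choose n) ^ 5 / (- (2 ^ 12)) ^ n *
     ((20 * (real n)\<^sup>2 + 8 * real n + 1) * (8 * harm2 (2 * n) - 3 * harm2 n) + 4)" for n
  proof -
    have d: "dlog12 n 0 = - (8 * harm2 (2 * n) - 3 * harm2 n)"
      by (simp add: dlog12_def odd_harm2_def)
    have "- (C * (- H * P + - 4)) = C * (P * H + 4)" for C H P :: real
      by (simp add: algebra_simps)
    then show ?thesis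
      unfolding G12_def of_nat_0 add_0_right term12_0_right cert12_0_right[OF of_nat_0_le_iff] d .
  qed
  with sums12 show ?thesis by simp
qed

section \<open>The series with base $-2^{20}$\<close>

text \<open>Here the deformed term is
  \<open>(-1)^n (1/2 + x)_(n+k) (1/2 - x)_(n+k) (1/2)_(n+k)\<^sup>2 (1/2 + x)_n\<^sup>2 (1/2 - x)_n\<^sup>2 (1/2)_n\<^sup>2\<close> divided by
  \<open>(1 + x)_(2n+k) (1 - x)_(2n+k) (2n+k)!\<^sup>2 (2n)!\<close>.\<close>

definition term20 :: "nat \<Rightarrow> nat \<Rightarrow> real" where
  "term20 n k = (-1) ^ n * cbin (n + k) ^ 4 * cbin n ^ 6 *
     (fact (n + k) * fact n / fact (2 * n + k)) ^ 4 * ((fact n)\<^sup>2 / fact (2 * n))"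

text \<open>The logarithmic derivative of the deformed term in \<open>x\<^sup>2\<close> at
  \<open>x = 0\<close>; the coefficient 2 reflects the squares of \<open>(1/2 + x)_n\<close> and
  \<open>(1/2 - x)_n\<close>.\<close>

definition dlog20 :: "nat \<Rightarrow> nat \<Rightarrow> real" where
  "dlog20 n k = harm2 (2 * n + k) - odd_harm2 (n + k) - 2 * odd_harm2 n"

definition cert20 :: "real \<Rightarrow> real \<Rightarrow> real" where
  "cert20 t c = 128 - 128 * t + 64 * t\<^sup>2 - 256 * c + 128 * c * t + 128 * c\<^sup>2 + 64 * t ^ 5 * (t - 2 * c) / c ^ 4"

text \<open>The derivative at \<open>y = 0\<close> of \<open>cert20\<close> after replacing
  \<open>64 * t\<^sup>2\<close> by \<open>64 * (t\<^sup>2 - y)\<close> and, in the fraction,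
  \<open>t ^ 4\<close> by \<open>(t\<^sup>2 - y)\<^sup>2\<close> and \<open>c ^ 4\<close> by
  \<open>c\<^sup>2 * (c\<^sup>2 - y)\<close>.\<close>

definition dcert20 :: "real \<Rightarrow> real \<Rightarrow> real" where
  "dcert20 t c = 64 * ((t ^ 6 - 2 * t ^ 5 * c - 2 * t ^ 4 * c\<^sup>2 + 4 * t ^ 3 * c ^ 3) / c ^ 6 - 1)"

definition F20 :: "nat \<Rightarrow> nat \<Rightarrow> real" where
  "F20 n k = term20 n k * (128 * real n * (6 * real n + 4 * real k + 1)) * dlog20 n k"

definition G20 :: "nat \<Rightarrow> nat \<Rightarrow> real" where
  "G20 n k = term20 n k * (dlog20 n k * cert20 (real n + 1/2) (2 * real n + real k + 1)
     + dcert20 (real n + 1/2) (2 * real n + real k + 1))"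

section \<open>The WZ equation and its derivative, base $-2^{20}$\<close>

lemma cert20_step:
  fixes t c d u :: real
  assumes "c \<noteq> 0" "d \<noteq> 0" "d = c + 1" "u = c - t"
  shows "- 64 * u ^ 4 * t ^ 5 * (2 * c - t + 2) / (c ^ 4 * d ^ 4) - 128 * (2 * t - 1) * (2 * c - t - 1)
    = u ^ 4 / c ^ 4 * cert20 t d - cert20 t c"
proof -
  have "64 * u ^ 4 * t ^ 5 * (2 * c - t + 2) + 128 * (2 * t - 1) * (2 * c - t - 1) * (c ^ 4 * d ^ 4)
     + u ^ 4 * ((128 - 128 * t + 64 * t\<^sup>2 - 256 * d + 128 * d * t + 128 * d\<^sup>2) * d ^ 4 + 64 * t ^ 5 * (t - 2 * d))
     - ((128 - 128 * t + 64 * t\<^sup>2 - 256 * c + 128 * c * t + 128 * c\<^sup>2) * c ^ 4 + 64 * t ^ 5 * (t - 2 * c)) * d ^ 4 = 0"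
    unfolding assms(3,4) by algebra
  then show ?thesis
    unfolding cert20_def using assms(1,2) by (simp add: divide_simps)
qed

lemma dcert20_step:
  fixes t c d u :: real
  assumes "c \<noteq> 0" "d \<noteq> 0" "d = c + 1" "u = c - t"
  shows "64 * t ^ 3 * u\<^sup>2 * (2 * c - t + 2) / (c ^ 4 * d ^ 4) * (t\<^sup>2 + 2 * u\<^sup>2 - t\<^sup>2 * u\<^sup>2 / c\<^sup>2 - t\<^sup>2 * u\<^sup>2 / d\<^sup>2)
    = (u ^ 4 / c\<^sup>2 - u\<^sup>2) / c ^ 4 * cert20 t d + u ^ 4 / c ^ 4 * dcert20 t d - dcert20 t c"
proof -
  have "64 * t ^ 3 * u\<^sup>2 * (2 * c - t + 2) * ((t\<^sup>2 + 2 * u\<^sup>2) * c\<^sup>2 * d\<^sup>2 - t\<^sup>2 * u\<^sup>2 * d\<^sup>2 - t\<^sup>2 * u\<^sup>2 * c\<^sup>2)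
    = (u ^ 4 - u\<^sup>2 * c\<^sup>2) * d\<^sup>2 *
        ((128 - 128 * t + 64 * t\<^sup>2 - 256 * d + 128 * d * t + 128 * d\<^sup>2) * d ^ 4 + 64 * t ^ 5 * (t - 2 * d))
     + u ^ 4 * c\<^sup>2 * (64 * ((t ^ 6 - 2 * t ^ 5 * d - 2 * t ^ 4 * d\<^sup>2 + 4 * t ^ 3 * d ^ 3) - d ^ 6))
     - 64 * ((t ^ 6 - 2 * t ^ 5 * c - 2 * t ^ 4 * c\<^sup>2 + 4 * t ^ 3 * c ^ 3) - c ^ 6) * d ^ 6" (is "?l = ?r")
    unfolding assms(3,4) by algebra
  then have "?l / (c ^ 6 * d ^ 6) = ?r / (c ^ 6 * d ^ 6)" by simp
  moreover have "?l / (c ^ 6 * d ^ 6)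
      = 64 * t ^ 3 * u\<^sup>2 * (2 * c - t + 2) / (c ^ 4 * d ^ 4) * (t\<^sup>2 + 2 * u\<^sup>2 - t\<^sup>2 * u\<^sup>2 / c\<^sup>2 - t\<^sup>2 * u\<^sup>2 / d\<^sup>2)"
    using assms(1,2) by (simp add: divide_simps power_numeral_reduce) (simp add: algebra_simps)
  moreover have "?r / (c ^ 6 * d ^ 6)
      = (u ^ 4 / c\<^sup>2 - u\<^sup>2) / c ^ 4 * cert20 t d + u ^ 4 / c ^ 4 * dcert20 t d - dcert20 t c"
    unfolding cert20_def dcert20_def
    using assms(1,2) by (simp add: divide_simps power_numeral_reduce)
  ultimately show ?thesis by simp
qed

lemma term20_Suc_left:
  fixes n k :: nat
  defines "t \<equiv> real n + 1/2" and "c \<equiv> 2 * real n + real k + 1" and "u \<equiv> real n + real k + 1/2"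
  shows "term20 (Suc n) k * (128 * real (Suc n) * (6 * real (Suc n) + 4 * real k + 1))
    = term20 n k * (- 64 * u ^ 4 * t ^ 5 * (2 * c - t + 2) / (c ^ 4 * (c + 1) ^ 4))"
proof -
  define v w where "v = u + 1/2" and "w = t + 1/2"
  define p q where "p = fact (n + k) * fact n / (fact (2 * n + k) :: real)"
    and "q = (fact n)\<^sup>2 / (fact (2 * n) :: real)"
  have nz: "t \<noteq> 0" "v \<noteq> 0" "w \<noteq> 0"
    unfolding t_def u_def v_def w_def by linarith+
  have p: "fact (Suc n + k) * fact (Suc n) / fact (2 * Suc n + k) = p * (v * w / (c * (c + 1)))"
    unfolding p_def t_def c_def u_def v_def w_def by (simp add: mult_ac add_ac)
  have "fact (2 * Suc n) = (2 * w) * (2 * t) * (fact (2 * n) :: real)"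
    unfolding w_def t_def by (simp add: algebra_simps)
  moreover have "(fact (Suc n))\<^sup>2 = w\<^sup>2 * (fact n :: real)\<^sup>2"
    unfolding w_def t_def by (simp add: power_mult_distrib add.commute)
  ultimately have q: "(fact (Suc n))\<^sup>2 / fact (2 * Suc n) = q * (w\<^sup>2 / (2 * w * (2 * t)))"
    unfolding q_def by (simp only: times_divide_times_eq mult_ac)
  have h: "cbin (Suc n + k) = cbin (n + k) * (u / v)" "cbin (Suc n) = cbin n * (t / w)"
    unfolding t_def u_def v_def w_def by (simp_all add: cbin_Suc)
  have f: "128 * real (Suc n) * (6 * real (Suc n) + 4 * real k + 1) = 128 * (2 * w) * (2 * c - t + 2)"
    unfolding t_def c_def w_def by (simp add: algebra_simps)
  \<comment> \<open>All powers of v and w cancel, one t is lost to \<open>fact (2 * Suc n)\<close>,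
    and \<open>128 * 2 / 4 = 64\<close>.\<close>
  have key: "(u / v) ^ 4 * (t / w) ^ 6 * (v * w / z) ^ 4 * (w\<^sup>2 / (2 * w * (2 * t))) * (128 * (2 * w))
      = 64 * u ^ 4 * t ^ 5 / z ^ 4" for z
    using nz by (simp add: power_mult_distrib power_divide power_numeral_reduce)
  have "term20 (Suc n) k * (128 * real (Suc n) * (6 * real (Suc n) + 4 * real k + 1))
      = - ((-1) ^ n * cbin (n + k) ^ 4 * cbin n ^ 6 * p ^ 4 * q * (2 * c - t + 2))
        * ((u / v) ^ 4 * (t / w) ^ 6 * (v * w / (c * (c + 1))) ^ 4 * (w\<^sup>2 / (2 * w * (2 * t))) * (128 * (2 * w)))"
    unfolding term20_def p q f h power_mult_distrib power_Suc by (simp only: mult_ac mult_minus_left mult_minus_right mult_1)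
  also have "\<dots> = term20 n k * (- 64 * u ^ 4 * t ^ 5 * (2 * c - t + 2) / (c ^ 4 * (c + 1) ^ 4))"
    unfolding key term20_def p_def[symmetric] q_def[symmetric] by (simp add: power_mult_distrib mult_ac)
  finally show ?thesis .
qed

lemma term20_Suc_right:
  "term20 n (Suc k) = term20 n k * ((real n + real k + 1/2) ^ 4 / (2 * real n + real k + 1) ^ 4)"
proof -
  define u v where "u = real n + real k + 1/2" and "v = real n + real k + 1"
  have v: "v \<noteq> 0" unfolding v_def by linarith
  have h: "cbin (n + Suc k) = cbin (n + k) * (u / v)"
    unfolding u_def v_def by (simp add: cbin_Suc)
  have p: "fact (n + Suc k) * fact n / fact (2 * n + Suc k)
      = fact (n + k) * fact n / fact (2 * n + k) * (v / (2 * real n + real k + 1))"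
    unfolding v_def by (simp add: mult_ac add_ac)
  show ?thesis
    unfolding term20_def h p u_def[symmetric] using v by (simp add: power_mult_distrib power_divide mult_ac)
qed

lemma dlog20_Suc_left:
  "dlog20 (Suc n) k = dlog20 n k + (1 / (2 * real n + real k + 1)\<^sup>2 + 1 / (2 * real n + real k + 1 + 1)\<^sup>2
     - 1 / (real n + real k + 1/2)\<^sup>2 - 2 / (real n + 1/2)\<^sup>2)"
  by (simp add: dlog20_def harm2_Suc odd_harm2_Suc add_ac)

lemma dlog20_Suc_right:
  "dlog20 n (Suc k) = dlog20 n k + (1 / (2 * real n + real k + 1)\<^sup>2 - 1 / (real n + real k + 1/2)\<^sup>2)"
  by (simp add: dlog20_def harm2_Suc odd_harm2_Suc)

lemma wz20: "F20 (Suc n) k - F20 n k = G20 n (Suc k) - G20 n k"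
proof -
  define t c d u where "t = real n + 1/2" and "c = 2 * real n + real k + 1"
    and "d = c + 1" and "u = real n + real k + 1/2"
  have nz: "t \<noteq> 0" "c \<noteq> 0" "d \<noteq> 0" "u \<noteq> 0" and uc: "u = c - t"
    unfolding t_def c_def d_def u_def by linarith+
  have f: "128 * real n * (6 * real n + 4 * real k + 1) = 128 * (2 * t - 1) * (2 * c - t - 1)"
    unfolding t_def c_def by (simp add: algebra_simps)
  have c: "2 * real n + real (Suc k) + 1 = d" unfolding c_def d_def by simp
  note left = term20_Suc_left[of n k, folded t_def c_def u_def, folded d_def]
  note right = term20_Suc_right[of n k, folded t_def c_def u_def]
  note dleft = dlog20_Suc_left[of n k, folded t_def c_def u_def, folded d_def]
  note dright = dlog20_Suc_right[of n k, folded c_def u_def]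
  have "- 64 * u ^ 4 * t ^ 5 * (2 * c - t + 2) / (c ^ 4 * d ^ 4) * (1 / c\<^sup>2 + 1 / d\<^sup>2 - 1 / u\<^sup>2 - 2 / t\<^sup>2)
      = - 64 * ((2 * c - t + 2) / (c ^ 4 * d ^ 4)) * (u ^ 4 * t ^ 5 * (1 / c\<^sup>2 + 1 / d\<^sup>2 - 1 / u\<^sup>2 - 2 / t\<^sup>2))"
    by (simp only: divide_inverse mult_ac)
  also have "u ^ 4 * t ^ 5 * (1 / c\<^sup>2 + 1 / d\<^sup>2 - 1 / u\<^sup>2 - 2 / t\<^sup>2)
      = - (t ^ 3 * u\<^sup>2 * (t\<^sup>2 + 2 * u\<^sup>2 - t\<^sup>2 * u\<^sup>2 / c\<^sup>2 - t\<^sup>2 * u\<^sup>2 / d\<^sup>2))"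
  proof -
    have "u ^ 4 = u\<^sup>2 * u\<^sup>2" "t ^ 5 = t ^ 3 * t\<^sup>2" by (simp_all flip: power_add)
    moreover have "u\<^sup>2 * (1 / u\<^sup>2) = 1" "t\<^sup>2 * (2 / t\<^sup>2) = 2" using nz by simp_all
    ultimately show ?thesis by algebra
  qed
  also have "- 64 * ((2 * c - t + 2) / (c ^ 4 * d ^ 4)) * \<dots>
      = 64 * t ^ 3 * u\<^sup>2 * (2 * c - t + 2) / (c ^ 4 * d ^ 4) * (t\<^sup>2 + 2 * u\<^sup>2 - t\<^sup>2 * u\<^sup>2 / c\<^sup>2 - t\<^sup>2 * u\<^sup>2 / d\<^sup>2)"
    by (simp only: divide_inverse mult_minus_left mult_minus_right minus_minus mult_ac)
  also have "\<dots> = (u ^ 4 / c\<^sup>2 - u\<^sup>2) / c ^ 4 * cert20 t d + u ^ 4 / c ^ 4 * dcert20 t d - dcert20 t c"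
    by (rule dcert20_step) (use nz uc d_def in auto)
  also have "u ^ 4 / c\<^sup>2 - u\<^sup>2 = u ^ 4 * (1 / c\<^sup>2 - 1 / u\<^sup>2)"
    using nz by (simp add: right_diff_distrib) (simp add: power_numeral_reduce)
  also have "u ^ 4 * (1 / c\<^sup>2 - 1 / u\<^sup>2) / c ^ 4 * cert20 t d + u ^ 4 / c ^ 4 * dcert20 t d
      = u ^ 4 / c ^ 4 * ((1 / c\<^sup>2 - 1 / u\<^sup>2) * cert20 t d + dcert20 t d)"
    by (simp only: divide_inverse distrib_left mult_ac)
  finally have deriv: "- 64 * u ^ 4 * t ^ 5 * (2 * c - t + 2) / (c ^ 4 * d ^ 4) * (1 / c\<^sup>2 + 1 / d\<^sup>2 - 1 / u\<^sup>2 - 2 / t\<^sup>2)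
      = u ^ 4 / c ^ 4 * ((1 / c\<^sup>2 - 1 / u\<^sup>2) * cert20 t d + dcert20 t d) - dcert20 t c" .
  show ?thesis
    unfolding F20_def G20_def c f
    unfolding t_def[symmetric] c_def[symmetric]
    by (rule wz_derivative_step[OF left dleft right dright _ deriv], rule cert20_step)
       (use nz uc d_def in auto)
qed

section \<open>Limits, bounds and summation, base $-2^{20}$\<close>

lemma dlog20_bound: "\<bar>dlog20 n k\<bar> \<le> 2 * pi\<^sup>2"
  using harm2_bounds[of "2 * n + k"] odd_harm2_bounds[of "n + k"] odd_harm2_bounds[of n]
  unfolding dlog20_def by (simp add: abs_le_iff)

lemma dlog20_tendsto: "dlog20 n \<longlonglongrightarrow> - (pi\<^sup>2 / 3) - 2 * odd_harm2 n"
proof -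
  have "(\<lambda>k. harm2 (2 * n + k) - odd_harm2 (n + k) - 2 * odd_harm2 n) \<longlonglongrightarrow> pi\<^sup>2 / 6 - pi\<^sup>2 / 2 - 2 * odd_harm2 n"
    using LIMSEQ_ignore_initial_segment[OF harm2_tendsto, of "2 * n"]
      LIMSEQ_ignore_initial_segment[OF odd_harm2_tendsto, of n]
    by (intro tendsto_diff tendsto_const) (simp_all add: add.commute)
  then show ?thesis unfolding dlog20_def by simp
qed

lemma cert20_tendsto:
  "(\<lambda>k. cert20 t (2 * real n + real k + 1) / (2 * real k + 1)\<^sup>2) \<longlonglongrightarrow> 32"
  unfolding cert20_def by real_asymp

lemma dcert20_tendsto:
  "(\<lambda>k. dcert20 t (2 * real n + real k + 1) / (2 * real k + 1)\<^sup>2) \<longlonglongrightarrow> 0"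
  unfolding dcert20_def by real_asymp

text \<open>One factor \<open>cbin (n + k)\<close> is kept, because \<open>term20_tendsto_0\<close>
  draws its limit from it; the other powers of \<open>cbin\<close> are bounded by 1.\<close>

lemma term20_bound:
  assumes "n \<ge> 1"
  shows "\<bar>term20 n k\<bar> \<le> cbin (n + k) * (1/2) ^ n / (real k + 1) ^ 4"
proof -
  have "\<bar>term20 n k\<bar> = cbin (n + k) * (cbin (n + k) ^ 3 * cbin n ^ 6) *
      (fact (n + k) * fact n / fact (2 * n + k)) ^ 4 * ((fact n)\<^sup>2 / fact (2 * n))"
    unfolding term20_def using cbin_pos
    by (simp add: abs_mult power_abs less_imp_le power_numeral_reduce)
  also have "\<dots> \<le> cbin (n + k) * (1 ^ 3 * 1 ^ 6) * (1 / (real k + 1)) ^ 4 * (1/2) ^ n"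
    using cbin_pos assms
    by (intro mult_mono power_mono cbin_le_1 fact_shift_quotient_le fact_square_quotient_le order_refl)
       (auto intro!: mult_nonneg_nonneg simp: less_imp_le)
  finally show ?thesis by (simp add: power_divide mult_ac)
qed

lemma term20_tendsto_0:
  assumes "n > 0"
  shows "(\<lambda>k. term20 n k * (2 * real k + 1)\<^sup>2) \<longlonglongrightarrow> 0"
proof (rule cbin_shift_null)
  fix k
  have "\<bar>term20 n k\<bar> \<le> cbin (n + k) * (1/2) ^ n / (real k + 1) ^ 4"
    using assms by (intro term20_bound) simp
  also have "\<dots> \<le> cbin (n + k) * 1 / (real k + 1)\<^sup>2"
    using cbin_pos[of "n + k"]
    by (intro frac_le mult_left_mono power_le_one power_increasing) auto
  finally show "\<bar>term20 n k\<bar> \<le> 1 * cbin (n + k) / (real k + 1)\<^sup>2" by simp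
qed simp

lemma F20_bound:
  assumes "n \<ge> 1"
  shows "\<bar>F20 n k\<bar> \<le> (1536 * pi\<^sup>2 * real n * (real n + 1) * (1/2) ^ n) * (1 / (real k + 1)\<^sup>2)"
proof -
  have "\<bar>term20 n k\<bar> \<le> cbin (n + k) * (1/2) ^ n / (real k + 1) ^ 4"
    by (rule term20_bound) fact
  also have "\<dots> \<le> 1 * (1/2) ^ n / (real k + 1) ^ 3"
    by (intro frac_le mult_right_mono cbin_le_1 power_increasing) auto
  finally have T: "\<bar>term20 n k\<bar> \<le> (1/2) ^ n / (real k + 1) ^ 3" by simp
  have f: "128 * real n * (6 * real n + 4 * real k + 1) \<le> 128 * real n * (6 * ((real n + 1) * (real k + 1)))"
    by (intro mult_left_mono) (auto simp: algebra_simps)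
  have "\<bar>F20 n k\<bar> = \<bar>term20 n k\<bar> * (128 * real n * (6 * real n + 4 * real k + 1)) * \<bar>dlog20 n k\<bar>"
    unfolding F20_def by (simp add: abs_mult)
  also have "\<dots> \<le> (1/2) ^ n / (real k + 1) ^ 3 * (128 * real n * (6 * ((real n + 1) * (real k + 1)))) * (2 * pi\<^sup>2)"
    by (intro mult_mono T f dlog20_bound) (auto intro!: mult_nonneg_nonneg)
  also have "\<dots> = (1536 * pi\<^sup>2 * real n * (real n + 1) * (1/2) ^ n) * (1 / (real k + 1)\<^sup>2)"
    by (simp add: power2_eq_square power3_eq_cube)
  finally show ?thesis .
qed

lemma sums20: "(\<lambda>n. - G20 n 0) sums (128 / 3)"
proof -
  have "(\<lambda>n. - G20 n 0) sums (- (- 128 / 3))"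
  proof (rule wz_sums[where F = F20 and G = G20 and m = 1, OF wz20])
    have "(\<lambda>k. term20 0 k * (2 * real k + 1)\<^sup>2) \<longlonglongrightarrow> 4 / pi\<^sup>2"
      using cbin_power4_tendsto by (simp add: term20_def)
    \<comment> \<open>As for base $-2^{12}$, but the leading term \<open>128 * c\<^sup>2\<close>
      makes the scaled certificate tend to 32.\<close>
    then have "G20 0 \<longlonglongrightarrow> 4 / pi\<^sup>2 * ((- (pi\<^sup>2 / 3) - 2 * odd_harm2 0) * 32)"
      unfolding G20_def by (intro boundary_tendsto dlog20_tendsto cert20_tendsto dcert20_tendsto)
    then show "G20 0 \<longlonglongrightarrow> - 128 / 3" by simp
    show "G20 n \<longlonglongrightarrow> 0" if "n > 0" for n
      using boundary_tendsto[OF term20_tendsto_0[OF that] dlog20_tendsto cert20_tendsto dcert20_tendsto]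
      unfolding G20_def by simp
    show "(\<lambda>n. 1536 * pi\<^sup>2 * real n * (real n + 1) * (1/2) ^ n) \<longlonglongrightarrow> 0" by real_asymp
    show "summable (\<lambda>k. 1 / (real k + 1)\<^sup>2)" using inverse_squares_sums by (simp add: sums_iff add.commute)
  qed (use F20_bound in \<open>auto simp: F20_def\<close>)
  then show ?thesis by simp
qed

section \<open>Evaluation at \<open>k = 0\<close>, base $-2^{20}$\<close>

lemma term20_0_right: "term20 n 0 = real ((2 * n) choose n) ^ 5 / (- (2 ^ 20)) ^ n"
proof -
  have "(fact n)\<^sup>2 / fact (2 * n) = 1 / (4 ^ n * cbin n)"
    by (simp add: cbin_eq_fact)
  \<comment> \<open>At \<open>k = 0\<close> the fourth power and the last factor of
    \<open>term20\<close> combine into a fifth power of one quotient.\<close>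
  then have "term20 n 0 = (-1) ^ n * cbin n ^ 10 * (1 / (4 ^ n * cbin n)) ^ 5"
    unfolding term20_def by (simp add: power2_eq_square numeral_eq_Suc mult_ac)
  also have "\<dots> = (-1) ^ n * cbin n ^ 5 / (4 ^ n) ^ 5"
    using cbin_pos[of n] by (simp add: numeral_eq_Suc)
  also have "\<dots> = real ((2 * n) choose n) ^ 5 / ((-1) ^ n * (4 ^ n) ^ 10)"
    by (simp add: cbin_def power_divide numeral_eq_Suc minus_one_power_iff)
  also have "(-1) ^ n * (4 ^ n) ^ 10 = (- (2 ^ 20) :: real) ^ n"
    by (simp add: power_mult[symmetric] mult.commute[of n] power_mult flip: power_mult_distrib)
  finally show ?thesis .
qed

text \<open>Again \<open>c = 2 * t\<close>, which leaves
  \<open>820 * t\<^sup>2 - 640 * t + 128\<close>; the fraction in \<open>dcert20\<close> becomes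
  21/64.\<close>

lemma cert20_0_right:
  fixes x :: real
  assumes "x \<ge> 0"
  shows "cert20 (x + 1/2) (2 * x + 1) = 820 * x\<^sup>2 + 180 * x + 13"
    and "dcert20 (x + 1/2) (2 * x + 1) = - 43"
proof -
  have c: "2 * x + 1 = 2 * (x + 1/2)" by simp
  have nz: "x + 1/2 \<noteq> 0" using assms by linarith
  have "64 * w ^ 5 * (w - 2 * (2 * w)) / (2 * w) ^ 4 = - 12 * w\<^sup>2" if "w \<noteq> 0" for w :: real
    using that by (simp add: power_mult_distrib power_numeral_reduce)
  from this[OF nz] show "cert20 (x + 1/2) (2 * x + 1) = 820 * x\<^sup>2 + 180 * x + 13"
    unfolding cert20_def c by (simp add: power2_eq_square algebra_simps)
  have "dcert20 w (2 * w) = - 43" if "w \<noteq> 0" for w :: real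
    unfolding dcert20_def using that by (simp add: field_simps) algebra
  from this[OF nz] show "dcert20 (x + 1/2) (2 * x + 1) = - 43"
    unfolding c .
qed

lemma series20:
  "(\<lambda>k. real ((2 * k) choose k) ^ 5 / (- (2 ^ 20)) ^ k *
     ((820 * (real k)\<^sup>2 + 180 * real k + 13) * (11 * harm2 (2 * k) - 3 * harm2 k) + 43)) sums (128 / 3)"
proof -
  have "- G20 n 0 = real ((2 * n) choose n) ^ 5 / (- (2 ^ 20)) ^ n *
     ((820 * (real n)\<^sup>2 + 180 * real n + 13) * (11 * harm2 (2 * n) - 3 * harm2 n) + 43)" for n
  proof -
    have d: "dlog20 n 0 = - (11 * harm2 (2 * n) - 3 * harm2 n)"
      by (simp add: dlog20_def odd_harm2_def)
    have "- (C * (- H * P + - 43)) = C * (P * H + 43)" for C H P :: real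
      by (simp add: algebra_simps)
    then show ?thesis
      unfolding G20_def of_nat_0 add_0_right term20_0_right cert20_0_right[OF of_nat_0_le_iff] d .
  qed
  with sums20 show ?thesis by simp
qed

theorem theorem1p3:
  shows "((\<lambda>k::nat. real ((2 * k) choose k) ^ 5 / (- (2 ^ 12)) ^ k *
            ((20 * (real k)\<^sup>2 + 8 * real k + 1) * (8 * harm2 (2 * k) - 3 * harm2 k) + 4))
          sums (8 / 3)) \<and>
         ((\<lambda>k::nat. real ((2 * k) choose k) ^ 5 / (- (2 ^ 20)) ^ k *
            ((820 * (real k)\<^sup>2 + 180 * real k + 13) * (11 * harm2 (2 * k) - 3 * harm2 k) + 43))
          sums (128 / 3))"
  using series12 series20 by blast

end
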